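(* For each of the families $\mathcal{W}_t=\{f_\lambda\}_{\lambda\in\mathbb{C}\setminus\{0\}}$ and $\mathcal{W}_s=\{f_\lambda\}_{\lambda\in\mathbb{C}\setminus\{0\}}$, the set of parameters $\lambda$ for which all critical values of $f_\lambda$ are prepoles is countable.
   Context: For a lattice $\Lambda=[\lambda_1,\lambda_2]=\{m\lambda_1+n\lambda_2: m,n\in\mathbb{Z}\}$ with $\lambda_2/\lambda_1\notin\mathbb{R}$, let $\wp_\Lambda(z)=\frac1{z^2}+\sum_{\omega\in\Lambda\setminus\{0\}}\left(\frac1{(z-\omega)^2}-\frac1{\omega^2}\right)$. For $\lambda\in\mathbb{C}\setminus\{0\}$ put $f_\lambda=\wp_{\Lambda_\lambda}:\mathbb{C}\to\overline{\mathbb{C}}$, where in the family $\mathcal{W}_t$ one takes $\Lambda_\lambda=[\lambda,e^{2\pi i/3}\lambda]$ and in the family $\mathcal{W}_s$ one takes $\Lambda_\lambda=[\lambda,i\lambda]$. Critical values of $f_\lambda$ are the three values $f_\lambda(c)\in\mathbb{C}$ with $c\in\mathbb{C}$, $f_\lambda'(c)=0$. A prepole is a point $z\in\mathbb{C}$ such that $f_\lambda^n(z)$ is a pole of $f_\lambda$ (i.e. a point of $\Lambda_\lambda$) for some $n\geq 0$; poles themselves are included. *)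

theory Defs
  imports "HOL-Complex_Analysis.Complex_Analysis"
begin

definition lattice :: "complex \<Rightarrow> complex \<Rightarrow> complex set" where
  "lattice a b = {of_int m * a + of_int n * b | m n :: int. True}"

text \<open>The value at the points of \<open>\<Lambda>\<close>, mathematically \<open>\<infinity>\<close>, is
  an arbitrary complex number here; the definitions below only evaluate the function off \<open>\<Lambda>\<close>.
  The series converges absolutely there, so \<open>infsum\<close> is its genuine sum.\<close>

definition weierstrass_p :: "complex set \<Rightarrow> complex \<Rightarrow> complex" where
  "weierstrass_p \<Lambda> z =
     1 / z\<^sup>2 + (\<Sum>\<^sub>\<infinity>\<omega>\<in>\<Lambda> - {0}. 1 / (z - \<omega>)\<^sup>2 - 1 / \<omega>\<^sup>2)"

text \<open>Only finite critical values: the poles, which are double and so ramified over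
  \<open>\<infinity>\<close>, are excluded.\<close>

definition critical_values :: "complex set \<Rightarrow> complex set" where
  "critical_values \<Lambda> =
     {weierstrass_p \<Lambda> c | c. c \<notin> \<Lambda> \<and> deriv (weierstrass_p \<Lambda>) c = 0}"

text \<open>The iterate of order \<open>n\<close> is defined at \<open>z\<close> only if no earlier iterate is a
  pole. The case \<open>n = 0\<close> says that the poles themselves are prepoles.\<close>

definition prepole :: "complex set \<Rightarrow> complex \<Rightarrow> bool" where
  "prepole \<Lambda> z \<longleftrightarrow>
     (\<exists>n. (\<forall>k<n. (weierstrass_p \<Lambda> ^^ k) z \<notin> \<Lambda>) \<and> (weierstrass_p \<Lambda> ^^ n) z \<in> \<Lambda>)"

definition triangular_lattice :: "complex \<Rightarrow> complex set" where
  "triangular_lattice l = lattice l (exp (2 * complex_of_real pi * \<i> / 3) * l)"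

definition square_lattice :: "complex \<Rightarrow> complex set" where
  "square_lattice l = lattice l (\<i> * l)"

end

theory Submission
  imports Defs
begin

text \<open>Let \<open>P\<close> be the Weierstrass function of the lattice with \<open>l = 1\<close> and
  \<open>e = P (1/2)\<close>. By homogeneity, the \<open>n\<close>-th iterate of \<open>f\<^sub>l\<close> at the critical
  value \<open>e / l\<^sup>2\<close> is \<open>l * h\<^sub>n l\<close>, where \<open>h\<^sub>0 l = e / l ^ 3\<close> and
  \<open>h\<^sub>n\<^sub>+\<^sub>1 l = P (h\<^sub>n l) / l ^ 3\<close>, so it is a pole of \<open>f\<^sub>l\<close> iff \<open>h\<^sub>n l\<close> is in the
  lattice of \<open>P\<close>. Inductively, \<open>h\<^sub>n\<close> is holomorphic on an open set with countable, hence
  connected, complement and has a pole at an isolated point of that complement. Hence \<open>h\<^sub>n\<close> is not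
  constant and takes each lattice value only countably often; and near its pole it takes all large
  values, so it hits some lattice point, which becomes a pole of \<open>h\<^sub>n\<^sub>+\<^sub>1\<close>. The induction starts
  because \<open>e \<noteq> 0\<close>: the symmetry of the lattice would otherwise make \<open>P\<close> vanish at two
  half-periods that are distinct modulo the lattice.\<close>

section \<open>Lattices in the plane\<close>

text \<open>A point off \<open>S\<close> keeps a neighbourhood off \<open>S\<close> once the
  finitely many nearby points of \<open>S\<close> are removed from a unit ball.\<close>

lemma closed_if_finite_on_cballs:
  fixes S :: "'a::real_normed_vector set"
  assumes "\<And>R. finite (S \<inter> cball 0 R)"
  shows "closed S"
proof -
  have "open (- S)"
  proof (subst open_subopen, rule ballI)
    fix z assume z: "z \<in> - S"
    let ?U = "ball z 1 - (S \<inter> cball 0 (norm z + 1))"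
    have "open ?U" using assms by (intro open_Diff finite_imp_closed) auto
    moreover have "z \<in> ?U" using z by auto
    moreover have "?U \<subseteq> - S"
    proof
      fix w assume w: "w \<in> ?U"
      have "norm w \<le> norm z + norm (w - z)"
        by (metis add.commute diff_add_cancel norm_triangle_ineq)
      with w show "w \<in> - S" by (auto simp: dist_norm norm_minus_commute)
    qed
    ultimately show "\<exists>T. open T \<and> z \<in> T \<and> T \<subseteq> - S" by blast
  qed
  then show ?thesis by (simp add: closed_def)
qed

lemma mem_lattice_iff: "z \<in> lattice a b \<longleftrightarrow> (\<exists>m n::int. z = of_int m * a + of_int n * b)"
  by (auto simp: lattice_def)

lemma lattice_scale: "lattice (c * a) (c * b) = (*) c ` lattice a b"
proof
  show "lattice (c * a) (c * b) \<subseteq> (*) c ` lattice a b"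
  proof
    fix z assume "z \<in> lattice (c * a) (c * b)"
    then obtain m n :: int where "z = c * (of_int m * a + of_int n * b)"
      by (auto simp: mem_lattice_iff algebra_simps)
    moreover have "of_int m * a + of_int n * b \<in> lattice a b" by (auto simp: mem_lattice_iff)
    ultimately show "z \<in> (*) c ` lattice a b" by blast
  qed
  show "(*) c ` lattice a b \<subseteq> lattice (c * a) (c * b)"
  proof
    fix z assume "z \<in> (*) c ` lattice a b"
    then obtain w where w: "w \<in> lattice a b" "z = c * w" by blast
    then obtain m n :: int where "w = of_int m * a + of_int n * b"
      unfolding mem_lattice_iff by blast
    with w have "z = of_int m * (c * a) + of_int n * (c * b)" by (simp add: algebra_simps)
    then show "z \<in> lattice (c * a) (c * b)" unfolding mem_lattice_iff by blast
  qed
qed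

section \<open>Discreteness of a lattice and convergence of its cubic norm sum\<close>

text \<open>As \<open>1\<close> and \<open>\<tau>\<close> are independent over the reals, the
  coordinate map is linear and injective on a finite-dimensional space, hence bounded below.\<close>

lemma lattice_norm_lower_bound:
  assumes "Im \<tau> \<noteq> 0"
  obtains B where "B > 0"
    and "\<And>m n::int. B * norm (real_of_int m, real_of_int n) \<le> norm (of_int m + of_int n * \<tau>)"
proof -
  let ?f = "\<lambda>p::real \<times> real. of_real (fst p) + of_real (snd p) * \<tau>"
  have lin: "linear ?f"
    by (rule linearI) (auto simp: algebra_simps scaleR_conv_of_real)
  have "inj ?f"
    unfolding linear_injective_0[OF lin]
    using assms by (auto simp: complex_eq_iff zero_prod_def)
  with lin obtain B where B: "B > 0" "\<And>p. B * norm p \<le> norm (?f p)"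
    using linear_inj_bounded_below_pos by blast
  show thesis
  proof (rule that[OF B(1)])
    show "B * norm (real_of_int m, real_of_int n) \<le> norm (of_int m + of_int n * \<tau>)" for m n :: int
      using B(2)[of "(real_of_int m, real_of_int n)"] by simp
  qed
qed

lemma finite_lattice_Int_cball:
  assumes "Im \<tau> \<noteq> 0"
  shows "finite (lattice 1 \<tau> \<inter> cball 0 R)"
proof -
  obtain B where B: "B > 0"
    "\<And>m n::int. B * norm (real_of_int m, real_of_int n) \<le> norm (of_int m + of_int n * \<tau>)"
    using lattice_norm_lower_bound[OF assms] by metis
  define N where "N = \<lceil>R / B\<rceil>"
  have "lattice 1 \<tau> \<inter> cball 0 R \<subseteq> (\<lambda>(m, n). of_int m + of_int n * \<tau>) ` ({-N..N} \<times> {-N..N})"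
  proof
    fix z assume z: "z \<in> lattice 1 \<tau> \<inter> cball 0 R"
    then obtain m n :: int where mn: "z = of_int m + of_int n * \<tau>"
      by (auto simp: mem_lattice_iff)
    have "norm (real_of_int m, real_of_int n) \<le> R / B"
      using B(2)[of m n] z B(1) mn by (simp add: pos_le_divide_eq mult.commute)
    moreover have "\<bar>real_of_int m\<bar> \<le> norm (real_of_int m, real_of_int n)"
      "\<bar>real_of_int n\<bar> \<le> norm (real_of_int m, real_of_int n)"
      using norm_fst_le[of "real_of_int m" "real_of_int n"]
        norm_snd_le[of "real_of_int n" "real_of_int m"] by simp_all
    ultimately have "\<bar>real_of_int m\<bar> \<le> R / B" "\<bar>real_of_int n\<bar> \<le> R / B" by linarith+
    then have "\<bar>m\<bar> \<le> N" "\<bar>n\<bar> \<le> N" unfolding N_def by linarith+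
    then show "z \<in> (\<lambda>(m, n). of_int m + of_int n * \<tau>) ` ({-N..N} \<times> {-N..N})"
      using mn by (auto simp: abs_le_iff intro!: image_eqI[of _ _ "(m, n)"])
  qed
  then show ?thesis by (rule finite_subset) auto
qed

text \<open>Because of \<open>max 1\<close> the term at \<open>0\<close> is \<open>1\<close>, so
  that products of two such terms can dominate the lattice sum on the coordinate axes too.\<close>

lemma summable_on_int_powr:
  fixes s :: real
  assumes "s > 1"
  shows "(\<lambda>m::int. max 1 \<bar>real_of_int m\<bar> powr (-s)) summable_on UNIV"
proof -
  let ?f = "\<lambda>m::int. max 1 \<bar>real_of_int m\<bar> powr (-s)"
  have "summable (\<lambda>n. real n powr (-s))"
    using assms by (simp add: summable_real_powr_iff)
  then have "summable (\<lambda>n. real (Suc n) powr (-s))"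
    by (subst summable_Suc_iff)
  moreover have "(\<lambda>n. ?f (int (Suc n))) = (\<lambda>n. real (Suc n) powr (-s))"
    by (auto simp: max_def)
  ultimately have "summable (\<lambda>n. ?f (int (Suc n)))" by simp
  then have "summable (\<lambda>n. ?f (int n))"
    by (subst (asm) summable_Suc_iff)
  then have nat: "(\<lambda>n. ?f (int n)) summable_on UNIV"
    by (subst summable_on_UNIV_nonneg_real_iff) auto
  have "?f summable_on range int"
    using nat by (subst summable_on_reindex) (auto simp: o_def)
  moreover have "?f summable_on range (\<lambda>n. - int n)"
    using nat by (subst summable_on_reindex) (auto simp: o_def inj_def)
  ultimately have "?f summable_on (range int \<union> range (\<lambda>n. - int n))"
    by (rule summable_on_union)
  moreover have "range int \<union> range (\<lambda>n. - int n) = UNIV"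
    by (auto simp: image_iff) (metis int_cases2)
  ultimately show ?thesis by simp
qed

text \<open>For \<open>(m, n)\<close> other than the origin, the product of
  \<open>max 1 \<bar>m\<bar>\<close> and \<open>max 1 \<bar>n\<bar>\<close> is at most the squared
  norm of \<open>(m, n)\<close>. Raised to the power \<open>3/2\<close>, this bounds the sum by a
  product of two convergent one-dimensional sums.\<close>

lemma lattice_summable:
  assumes "Im \<tau> \<noteq> 0"
  shows "(\<lambda>\<omega>. 1 / norm \<omega> ^ 3) summable_on (lattice 1 \<tau> - {0})"
proof -
  obtain B where B: "B > 0"
    "\<And>m n::int. B * norm (real_of_int m, real_of_int n) \<le> norm (of_int m + of_int n * \<tau>)"
    using lattice_norm_lower_bound[OF assms] by metis
  let ?u = "\<lambda>m::int. max 1 \<bar>real_of_int m\<bar> powr (-(3/2))"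
  let ?g = "\<lambda>p::int \<times> int. of_int (fst p) + of_int (snd p) * \<tau>"
  have u: "(?u has_sum infsum ?u UNIV) UNIV"
    using summable_on_int_powr[of "3/2"] by (intro has_sum_infsum) auto
  have "(\<lambda>p. ?u (fst p) * ?u (snd p)) summable_on (UNIV \<times> UNIV)"
  proof (rule summable_on_SigmaI)
    show "((\<lambda>y. ?u (fst (x, y)) * ?u (snd (x, y))) has_sum ?u x * infsum ?u UNIV) UNIV" for x
      using has_sum_cmult_right[OF u, of "?u x"] by simp
    show "(\<lambda>x. ?u x * infsum ?u UNIV) summable_on UNIV"
      using u by (intro summable_on_cmult_left) (auto simp: has_sum_iff)
  qed auto
  then have "(\<lambda>p. ?u (fst p) * ?u (snd p)) summable_on (UNIV - {(0, 0)})"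
    by (rule summable_on_subset) auto
  then have "(\<lambda>p. (1 / B ^ 3) * (?u (fst p) * ?u (snd p))) summable_on (UNIV - {(0, 0)})"
    by (rule summable_on_cmult_right)
  then have "(\<lambda>p. 1 / norm (?g p) ^ 3) summable_on (UNIV - {(0, 0)})"
  proof (rule summable_on_comparison_test)
    fix p :: "int \<times> int" assume p: "p \<in> UNIV - {(0, 0)}"
    obtain m n where mn: "p = (m, n)" by fastforce
    let ?M = "max 1 \<bar>real_of_int m\<bar>" and ?N = "max 1 \<bar>real_of_int n\<bar>"
    let ?r = "norm (real_of_int m, real_of_int n)"
    have r2: "?r\<^sup>2 = (real_of_int m)\<^sup>2 + (real_of_int n)\<^sup>2"
      by (simp add: norm_Pair)
    have "m \<noteq> 0 \<or> n \<noteq> 0" using p mn by auto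
    then have "\<bar>real_of_int m\<bar> \<ge> 1 \<or> \<bar>real_of_int n\<bar> \<ge> 1" by linarith
    then have "1\<^sup>2 \<le> \<bar>real_of_int m\<bar>\<^sup>2 \<or> 1\<^sup>2 \<le> \<bar>real_of_int n\<bar>\<^sup>2"
      by (meson power_mono zero_le_one)
    then have one: "1 \<le> ?r\<^sup>2" using r2 by (auto intro: add_increasing add_increasing2)
    have "?M\<^sup>2 \<le> ?r\<^sup>2" "?N\<^sup>2 \<le> ?r\<^sup>2"
      using one r2 by (auto simp: max_def)
    moreover have "2 * (?M * ?N) \<le> ?M\<^sup>2 + ?N\<^sup>2"
      using sum_squares_bound[of ?M ?N] by simp
    ultimately have MN: "?M * ?N \<le> ?r\<^sup>2" by linarith
    have r0: "?r > 0" using one by (smt (verit) norm_ge_zero power_zero_numeral)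
    have "(?M * ?N) powr (3/2) \<le> (?r\<^sup>2) powr (3/2)"
      by (rule powr_mono2) (use MN in auto)
    also have "(?r\<^sup>2) powr (3/2) = ?r ^ 3"
      using r0 by (simp add: powr_numeral[symmetric] powr_powr del: powr_numeral)
    finally have le: "(?M * ?N) powr (3/2) \<le> ?r ^ 3" .
    have "(B * ?r) ^ 3 \<le> norm (?g p) ^ 3"
      using B(2)[of m n] B(1) by (intro power_mono) (auto simp: mn)
    moreover have "(B * ?r) ^ 3 \<ge> B ^ 3 * (?M * ?N) powr (3/2)"
      using le B(1) by (simp add: power_mult_distrib)
    moreover have pos: "B ^ 3 * (?M * ?N) powr (3/2) > 0"
      using B(1) by (intro mult_pos_pos zero_less_power) (auto simp: max_def)
    ultimately have "1 / norm (?g p) ^ 3 \<le> 1 / (B ^ 3 * (?M * ?N) powr (3/2))"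
      by (intro frac_le) linarith+
    also have "\<dots> = (1 / B ^ 3) * (?u m * ?u n)"
      by (simp add: powr_mult powr_minus divide_simps)
    finally show "1 / norm (?g p) ^ 3 \<le> (1 / B ^ 3) * (?u (fst p) * ?u (snd p))"
      by (simp add: mn)
  qed auto
  moreover have "bij_betw ?g (UNIV - {(0, 0)}) (lattice 1 \<tau> - {0})"
  proof -
    have inj: "inj ?g" using assms by (auto simp: inj_def complex_eq_iff)
    have "?g ` UNIV = lattice 1 \<tau>" by (auto simp: lattice_def image_iff) blast
    moreover have "?g ` {(0, 0)} = {0}" by simp
    ultimately have "?g ` (UNIV - {(0, 0)}) = lattice 1 \<tau> - {0}"
      using image_set_diff[OF inj, of UNIV "{(0, 0)}"] by simp
    with inj show ?thesis by (auto simp: bij_betw_def intro: inj_on_subset)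
  qed
  ultimately show ?thesis
    using summable_on_reindex_bij_betw[of ?g "UNIV - {(0, 0)}" "lattice 1 \<tau> - {0}"
        "\<lambda>\<omega>. 1 / norm \<omega> ^ 3"] by simp
qed

section \<open>The lattice properties used by the analysis\<close>

text \<open>The properties shared by both families: a discrete subgroup, the summability behind the
  series, and \<open>cocompact\<close> in the role of a fundamental parallelogram.\<close>

locale planar_lattice =
  fixes \<Lambda> :: "complex set"
  assumes zero_mem: "0 \<in> \<Lambda>"
    and diff_mem: "\<And>x y. x \<in> \<Lambda> \<Longrightarrow> y \<in> \<Lambda> \<Longrightarrow> x - y \<in> \<Lambda>"
    and finite_Int_cball: "\<And>R. finite (\<Lambda> \<inter> cball 0 R)"
    and summable_norm_cube: "(\<lambda>\<omega>. 1 / norm \<omega> ^ 3) summable_on (\<Lambda> - {0})"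
    and cocompact: "\<exists>K. compact K \<and> (\<forall>z. \<exists>\<omega>\<in>\<Lambda>. z - \<omega> \<in> K)"

lemma planar_lattice_lattice:
  assumes "Im \<tau> \<noteq> 0"
  shows "planar_lattice (lattice 1 \<tau>)"
proof
  show "0 \<in> lattice 1 \<tau>" by (auto simp: mem_lattice_iff intro!: exI[of _ 0])
  show "x - y \<in> lattice 1 \<tau>" if xy: "x \<in> lattice 1 \<tau>" "y \<in> lattice 1 \<tau>" for x y
  proof -
    obtain m n m' n' :: int where "x = of_int m + of_int n * \<tau>" "y = of_int m' + of_int n' * \<tau>"
      using xy by (auto simp: mem_lattice_iff)
    then have "x - y = of_int (m - m') * 1 + of_int (n - n') * \<tau>" by (simp add: algebra_simps)
    then show ?thesis unfolding mem_lattice_iff by blast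
  qed
  show "finite (lattice 1 \<tau> \<inter> cball 0 R)" for R by (rule finite_lattice_Int_cball[OF assms])
  show "(\<lambda>\<omega>. 1 / norm \<omega> ^ 3) summable_on (lattice 1 \<tau> - {0})" by (rule lattice_summable[OF assms])
  show "\<exists>K. compact K \<and> (\<forall>z. \<exists>\<omega>\<in>lattice 1 \<tau>. z - \<omega> \<in> K)"
  proof (intro exI conjI allI)
    show "compact (cball (0::complex) (1 + norm \<tau>))" by simp
    fix z :: complex
    \<comment> \<open>\<open>x\<close> and \<open>y\<close> are the real coordinates of
      \<open>z\<close> in the basis \<open>1, \<tau>\<close>; subtracting their integer parts leaves
      a bounded remainder.\<close>
    define y where "y = Im z / Im \<tau>"
    define x where "x = Re z - y * Re \<tau>"
    have z: "z = of_real x + of_real y * \<tau>"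
      using assms by (simp add: complex_eq_iff x_def y_def)
    let ?w = "of_int \<lfloor>x\<rfloor> + of_int \<lfloor>y\<rfloor> * \<tau>"
    have "z - ?w = of_real (frac x) + of_real (frac y) * \<tau>"
      by (subst z) (simp add: frac_def algebra_simps)
    then have "norm (z - ?w) \<le> norm (of_real (frac x) :: complex) + norm (of_real (frac y) * \<tau>)"
      by (metis norm_triangle_ineq)
    also have "\<dots> \<le> 1 + norm \<tau>"
      using frac_lt_1[of x] frac_lt_1[of y] frac_ge_0[of x] frac_ge_0[of y]
      by (auto simp: norm_mult intro!: add_mono mult_left_le_one_le)
    finally have "z - ?w \<in> cball 0 (1 + norm \<tau>)" by simp
    moreover have "?w \<in> lattice 1 \<tau>" by (auto simp: mem_lattice_iff)
    ultimately show "\<exists>\<omega>\<in>lattice 1 \<tau>. z - \<omega> \<in> cball 0 (1 + norm \<tau>)" by blast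
  qed
qed

lemma connected_if_countable_Compl:
  fixes S :: "complex set"
  assumes "countable (- S)"
  shows "connected S"
  using connected_open_diff_countable[of UNIV "- S"] assms
  by (simp add: connected_UNIV flip: Compl_eq_Diff_UNIV)

text \<open>Supplies the topological hypothesis of the countability theorems for fibres of
  holomorphic functions.\<close>

lemma open_imp_fsigma:
  fixes S :: "'a::euclidean_space set"
  assumes "open S"
  shows "fsigma S"
  using open_Union_compact_subsets[OF assms] fsigma.intros compact_imp_closed by metis

section \<open>The Weierstrass function of a lattice\<close>

text \<open>Homogeneity of degree -2: multiplication by \<open>c\<close> matches the lattice points,
  and each term acquires the factor \<open>1 / c\<^sup>2\<close>.\<close>

lemma weierstrass_p_scale:
  assumes "c \<noteq> 0"
  shows "weierstrass_p ((*) c ` \<Lambda>) (c * z) = weierstrass_p \<Lambda> z / c\<^sup>2"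
proof -
  have bij: "bij_betw ((*) c) (\<Lambda> - {0}) ((*) c ` \<Lambda> - {0})"
    using assms by (auto simp: bij_betw_def inj_on_def)
  have "(\<Sum>\<^sub>\<infinity>\<omega>\<in>(*) c ` \<Lambda> - {0}. 1 / (c * z - \<omega>)\<^sup>2 - 1 / \<omega>\<^sup>2)
      = (\<Sum>\<^sub>\<infinity>\<omega>\<in>\<Lambda> - {0}. 1 / (c * z - c * \<omega>)\<^sup>2 - 1 / (c * \<omega>)\<^sup>2)"
    by (rule infsum_reindex_bij_betw[OF bij, symmetric])
  also have "\<dots> = (\<Sum>\<^sub>\<infinity>\<omega>\<in>\<Lambda> - {0}. (1 / c\<^sup>2) * (1 / (z - \<omega>)\<^sup>2 - 1 / \<omega>\<^sup>2))"
  proof (rule infsum_cong)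
    fix \<omega>
    have "c * z - c * \<omega> = c * (z - \<omega>)" by (simp add: algebra_simps)
    then have "(c * z - c * \<omega>)\<^sup>2 = c\<^sup>2 * (z - \<omega>)\<^sup>2" by (simp only: power_mult_distrib)
    then show "1 / (c * z - c * \<omega>)\<^sup>2 - 1 / (c * \<omega>)\<^sup>2 = (1 / c\<^sup>2) * (1 / (z - \<omega>)\<^sup>2 - 1 / \<omega>\<^sup>2)"
      by (simp add: power_mult_distrib right_diff_distrib)
  qed
  also have "\<dots> = (1 / c\<^sup>2) * (\<Sum>\<^sub>\<infinity>\<omega>\<in>\<Lambda> - {0}. 1 / (z - \<omega>)\<^sup>2 - 1 / \<omega>\<^sup>2)"
    by (rule infsum_cmult_right')
  finally show ?thesis
    by (simp add: weierstrass_p_def power_mult_distrib add_divide_distrib mult.commute)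
qed

lemma inverse_square_has_field_derivative:
  fixes z \<omega> :: complex
  assumes "z \<noteq> \<omega>"
  shows "((\<lambda>z. 1 / (z - \<omega>)\<^sup>2) has_field_derivative - 2 / (z - \<omega>) ^ 3) (at z)"
  using assms
  by (auto intro!: derivative_eq_intros simp: divide_simps power2_eq_square power3_eq_cube)

context planar_lattice
begin

abbreviation P :: "complex \<Rightarrow> complex" where "P \<equiv> weierstrass_p \<Lambda>"

abbreviation term_at :: "complex \<Rightarrow> complex \<Rightarrow> complex" where
  "term_at \<omega> z \<equiv> 1 / (z - \<omega>)\<^sup>2 - 1 / \<omega>\<^sup>2"

lemma uminus_mem: "x \<in> \<Lambda> \<Longrightarrow> - x \<in> \<Lambda>"
  using diff_mem[OF zero_mem] by simp

lemma add_mem: "x \<in> \<Lambda> \<Longrightarrow> y \<in> \<Lambda> \<Longrightarrow> x + y \<in> \<Lambda>"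
  using diff_mem[of x "- y"] uminus_mem by simp

lemma uminus_mem_iff [simp]: "- x \<in> \<Lambda> \<longleftrightarrow> x \<in> \<Lambda>"
  using uminus_mem[of x] uminus_mem[of "- x"] by auto

lemma add_mem_iff: "\<omega> \<in> \<Lambda> \<Longrightarrow> z + \<omega> \<in> \<Lambda> \<longleftrightarrow> z \<in> \<Lambda>"
  using add_mem[of z \<omega>] diff_mem[of "z + \<omega>" \<omega>] by auto

lemma diff_mem_iff: "\<omega> \<in> \<Lambda> \<Longrightarrow> z - \<omega> \<in> \<Lambda> \<longleftrightarrow> z \<in> \<Lambda>"
  using add_mem_iff[of "- \<omega>" z] by simp

lemma closed_subset: "S \<subseteq> \<Lambda> \<Longrightarrow> closed S"
  by (rule closed_if_finite_on_cballs) (meson Int_mono finite_Int_cball finite_subset order_refl)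

lemma countable_lattice: "countable \<Lambda>"
proof -
  have "\<Lambda> = (\<Union>n. \<Lambda> \<inter> cball 0 (real n))"
    by (auto intro: real_arch_simple)
  moreover have "countable (\<Union>n. \<Lambda> \<inter> cball 0 (real n))"
    by (rule countable_UN) (auto intro: countable_finite finite_Int_cball)
  ultimately show ?thesis by simp
qed

text \<open>The translates of a compact set by a bounded set cannot cover the plane.\<close>

lemma exists_large: "\<exists>\<omega>\<in>\<Lambda>. norm \<omega> > B"
proof (rule ccontr)
  assume neg: "\<not> ?thesis"
  obtain K where K: "compact K" "\<And>z. \<exists>\<omega>\<in>\<Lambda>. z - \<omega> \<in> K" using cocompact by blast
  obtain C where C: "\<And>z. z \<in> K \<Longrightarrow> norm z \<le> C"
    using compact_imp_bounded[OF K(1)] by (auto simp: bounded_iff)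
  let ?z = "of_real (\<bar>B\<bar> + \<bar>C\<bar> + 1) :: complex"
  obtain \<omega> where \<omega>: "\<omega> \<in> \<Lambda>" "?z - \<omega> \<in> K" using K(2) by blast
  have "norm \<omega> \<le> B" using neg \<omega> by force
  moreover have "norm (?z - \<omega>) \<le> C" using C \<omega> by blast
  moreover have "norm ?z = \<bar>B\<bar> + \<bar>C\<bar> + 1" by (subst norm_of_real) simp
  ultimately show False
    using norm_triangle_ineq[of "?z - \<omega>" \<omega>] by simp
qed

lemma open_compl: "open (- \<Lambda>)"
  using closed_subset[of \<Lambda>] by auto

lemma connected_compl: "connected (- \<Lambda>)"
  by (rule connected_if_countable_Compl) (simp add: countable_lattice)

section \<open>Convergence and termwise differentiation of the series\<close>

text \<open>Over a common denominator the leading terms cancel: the numerator grows only like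
  \<open>norm \<omega>\<close> and the denominator like its fourth power. This is the majorant for
  the M-test.\<close>

lemma term_at_bound:
  assumes "norm z \<le> R" "norm \<omega> > 2 * R"
  shows "norm (term_at \<omega> z) \<le> 10 * R * (1 / norm \<omega> ^ 3)"
proof -
  let ?r = "norm \<omega>"
  have R: "R \<ge> 0" using assms(1) norm_ge_zero order_trans by blast
  have w0: "\<omega> \<noteq> 0" and zw: "z \<noteq> \<omega>" using assms R by auto
  have eq: "term_at \<omega> z = z * (2 * \<omega> - z) / (\<omega>\<^sup>2 * (z - \<omega>)\<^sup>2)"
    using w0 zw by (simp add: divide_simps) (simp add: power2_eq_square algebra_simps)
  have a: "norm (2 * \<omega> - z) \<le> 5/2 * ?r"
    using norm_triangle_ineq4[of "2 * \<omega>" z] assms by (simp add: norm_mult)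
  have b: "norm (z - \<omega>) \<ge> ?r / 2"
    using norm_triangle_ineq2[of \<omega> z] assms by (simp add: norm_minus_commute)
  have b2: "(?r / 2)\<^sup>2 \<le> (norm (z - \<omega>))\<^sup>2"
    by (rule power_mono[OF b]) simp
  have "norm (term_at \<omega> z) = norm z * norm (2 * \<omega> - z) / (?r\<^sup>2 * (norm (z - \<omega>))\<^sup>2)"
    unfolding eq by (simp add: norm_mult norm_divide norm_power)
  also have "\<dots> \<le> R * (5/2 * ?r) / (?r\<^sup>2 * (?r / 2)\<^sup>2)"
    using a b2 assms R w0 zw by (intro frac_le mult_mono mult_pos_pos) auto
  also have "\<dots> = 10 * R * (1 / ?r ^ 3)"
    using w0 by (simp add: power2_eq_square power3_eq_cube field_simps)
  finally show ?thesis .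
qed

text \<open>The factor 2 keeps each \<open>\<omega>\<close> at distance at least
  \<open>norm \<omega> / 2\<close> from the disc of radius \<open>R\<close>, so the terms have no
  poles there.\<close>

definition far :: "real \<Rightarrow> complex set" where "far R = {\<omega> \<in> \<Lambda>. norm \<omega> > 2 * R}"

definition tail :: "real \<Rightarrow> complex \<Rightarrow> complex" where
  "tail R z = (\<Sum>\<^sub>\<infinity>\<omega>\<in>far R. term_at \<omega> z)"

lemma far_summable:
  assumes "R > 0"
  shows "(\<lambda>\<omega>. 10 * R * (1 / norm \<omega> ^ 3)) summable_on far R"
  using assms
  by (intro summable_on_cmult_right summable_on_subset[OF summable_norm_cube]) (auto simp: far_def)

lemma far_term_summable:
  assumes "R > 0" "norm z \<le> R"
  shows "(\<lambda>\<omega>. term_at \<omega> z) summable_on far R"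
  by (rule abs_summable_summable, rule Infinite_Sum.abs_summable_on_comparison_test'[OF far_summable[OF assms(1)]],
      rule term_at_bound) (use assms in \<open>auto simp: far_def\<close>)

text \<open>Finite partial sums converge uniformly on the disc by the M-test, so their derivatives
  converge to that of the limit. The second conclusion identifies the derivative as a
  series.\<close>

lemma tail_has_field_derivative:
  assumes "R > 0" "norm z < R"
  obtains d where "(tail R has_field_derivative d) (at z)"
    and "((\<lambda>\<omega>. - 2 / (z - \<omega>) ^ 3) has_sum d) (far R)"
proof -
  let ?F = "finite_subsets_at_top (far R)"
  let ?f = "\<lambda>X z. \<Sum>\<omega>\<in>X. term_at \<omega> z" and ?f' = "\<lambda>X z. \<Sum>\<omega>\<in>X. - 2 / (z - \<omega>) ^ 3"
  have ulim: "uniform_limit (cball 0 R) ?f (tail R) ?F"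
    unfolding tail_def
    by (rule Weierstrass_m_test_general[OF _ far_summable[OF assms(1)]])
      (rule term_at_bound, auto simp: far_def)
  have D: "((\<lambda>z. term_at \<omega> z) has_field_derivative - 2 / (w - \<omega>) ^ 3) (at w)"
    if "\<omega> \<in> far R" "w \<in> cball 0 R" for \<omega> w
  proof -
    have "w \<noteq> \<omega>" using that assms by (auto simp: far_def)
    then show ?thesis
      using DERIV_diff[OF inverse_square_has_field_derivative DERIV_const] by fastforce
  qed
  have ev: "\<forall>\<^sub>F X in ?F. continuous_on (cball 0 R) (?f X) \<and>
      (\<forall>w\<in>ball 0 R. (?f X has_field_derivative ?f' X w) (at w))"
  proof (rule eventually_finite_subsets_at_top_weakI)
    fix X assume X: "finite X" "X \<subseteq> far R"
    have d: "(?f X has_field_derivative ?f' X w) (at w)" if "w \<in> cball 0 R" for w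
      by (rule DERIV_sum) (use D X that in blast)
    then show "continuous_on (cball 0 R) (?f X) \<and>
      (\<forall>w\<in>ball 0 R. (?f X has_field_derivative ?f' X w) (at w))"
      by (auto intro!: DERIV_isCont continuous_at_imp_continuous_on)
  qed
  obtain g' where "\<And>w. w \<in> ball 0 R \<Longrightarrow>
      (tail R has_field_derivative g' w) (at w) \<and> ((\<lambda>X. ?f' X w) \<longlongrightarrow> g' w) ?F"
    using has_complex_derivative_uniform_limit[OF ev ulim _ assms(1)] by auto
  then show thesis using that[of "g' z"] assms by (auto simp: has_sum_def)
qed

lemma tail_holomorphic:
  assumes "R > 0"
  shows "tail R holomorphic_on ball 0 R"
  unfolding holomorphic_on_open[OF open_ball]
  using tail_has_field_derivative[OF assms] by (metis mem_ball_0)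

text \<open>On a disc this leaves a finite rational part plus a \<open>tail\<close> that is
  holomorphic inside.\<close>

lemma P_eq_tail:
  assumes "R > 0" "norm z \<le> R"
  shows "P z = 1 / z\<^sup>2 + (\<Sum>\<omega>\<in>\<Lambda> \<inter> cball 0 (2 * R) - {0}. term_at \<omega> z) + tail R z"
proof -
  have split: "\<Lambda> - {0} = (\<Lambda> \<inter> cball 0 (2 * R) - {0}) \<union> far R"
    using assms by (auto simp: far_def)
  have fin: "finite (\<Lambda> \<inter> cball 0 (2 * R) - {0})" using finite_Int_cball by simp
  show ?thesis
    unfolding weierstrass_p_def split tail_def
    using fin far_term_summable[OF assms]
    by (subst infsum_Un_disjoint) (auto simp: far_def)
qed

text \<open>The derivative of \<open>1 / z\<^sup>2\<close> supplies the term at \<open>0\<close>, so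
  the series runs over all of \<open>\<Lambda>\<close> and its symmetries become
  reindexings.\<close>

lemma P_has_field_derivative:
  assumes "z \<notin> \<Lambda>"
  shows "(P has_field_derivative (\<Sum>\<^sub>\<infinity>\<omega>\<in>\<Lambda>. - 2 / (z - \<omega>) ^ 3)) (at z)"
proof -
  define R where "R = norm z + 1"
  have R: "R > 0" "norm z < R" by (auto simp: R_def add_nonneg_pos)
  let ?G = "\<Lambda> \<inter> cball 0 (2 * R)"
  have fin: "finite ?G" by (rule finite_Int_cball)
  obtain d where d: "(tail R has_field_derivative d) (at z)"
    "((\<lambda>\<omega>. - 2 / (z - \<omega>) ^ 3) has_sum d) (far R)"
    using tail_has_field_derivative[OF R] .
  have "((\<lambda>\<omega>. - 2 / (z - \<omega>) ^ 3) has_sum ((\<Sum>\<omega>\<in>?G. - 2 / (z - \<omega>) ^ 3) + d)) (?G \<union> far R)"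
    using fin by (intro has_sum_Un_disjoint d(2) has_sum_finite) (auto simp: far_def)
  moreover have "?G \<union> far R = \<Lambda>" by (auto simp: far_def)
  ultimately have sum: "(\<Sum>\<^sub>\<infinity>\<omega>\<in>\<Lambda>. - 2 / (z - \<omega>) ^ 3) = (\<Sum>\<omega>\<in>?G. - 2 / (z - \<omega>) ^ 3) + d"
    by (simp add: infsumI)
  have split: "(\<Sum>\<omega>\<in>?G. - 2 / (z - \<omega>) ^ 3) = - 2 / z ^ 3 + (\<Sum>\<omega>\<in>?G - {0}. - 2 / (z - \<omega>) ^ 3)"
    using fin zero_mem R by (subst sum.remove[of _ 0]) auto
  have z0: "z \<noteq> 0" using assms zero_mem by auto
  have sq: "((\<lambda>z. 1 / z\<^sup>2) has_field_derivative - 2 / z ^ 3) (at z)"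
    using inverse_square_has_field_derivative[OF z0] by simp
  have fs: "((\<lambda>z. \<Sum>\<omega>\<in>?G - {0}. term_at \<omega> z) has_field_derivative
      (\<Sum>\<omega>\<in>?G - {0}. - 2 / (z - \<omega>) ^ 3)) (at z)"
  proof (rule DERIV_sum)
    fix \<omega> assume "\<omega> \<in> ?G - {0}"
    then have "z \<noteq> \<omega>" using assms by auto
    then show "(term_at \<omega> has_field_derivative - 2 / (z - \<omega>) ^ 3) (at z)"
      using DERIV_diff[OF inverse_square_has_field_derivative DERIV_const] by fastforce
  qed
  have "((\<lambda>z. 1 / z\<^sup>2 + (\<Sum>\<omega>\<in>?G - {0}. term_at \<omega> z) + tail R z) has_field_derivative
      (\<Sum>\<^sub>\<infinity>\<omega>\<in>\<Lambda>. - 2 / (z - \<omega>) ^ 3)) (at z)"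
    unfolding sum split by (intro DERIV_add sq fs d(1))
  then show ?thesis
    by (rule has_field_derivative_transform_within_open[of _ _ _ "ball 0 R"])
      (use R P_eq_tail in auto)
qed

lemma P_holomorphic: "P holomorphic_on - \<Lambda>"
  unfolding holomorphic_on_open[OF open_compl] using P_has_field_derivative by blast

section \<open>Symmetries and half-periods\<close>

lemma P_uminus: "P (- z) = P z"
proof -
  have "infsum (\<lambda>\<omega>. term_at \<omega> z) (\<Lambda> - {0}) = infsum (\<lambda>\<omega>. term_at \<omega> (- z)) (\<Lambda> - {0})"
    by (rule infsum_reindex_bij_witness[of _ uminus uminus])
      (auto simp: power2_commute[of z] add.commute)
  then show ?thesis by (simp add: weierstrass_p_def)
qed

lemma dP_add:
  assumes "\<omega>0 \<in> \<Lambda>"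
  shows "(\<Sum>\<^sub>\<infinity>\<omega>\<in>\<Lambda>. - 2 / (z + \<omega>0 - \<omega>) ^ 3) = (\<Sum>\<^sub>\<infinity>\<omega>\<in>\<Lambda>. - 2 / (z - \<omega>) ^ 3)"
  by (rule infsum_reindex_bij_witness[of _ "\<lambda>\<omega>. \<omega> + \<omega>0" "\<lambda>\<omega>. \<omega> - \<omega>0"])
    (use assms in \<open>auto simp: add_mem diff_mem algebra_simps\<close>)

text \<open>The derivative is periodic by \<open>dP_add\<close>, so on the connected complement of
  \<open>\<Lambda>\<close> a translation by a period changes \<open>P\<close> by a constant.\<close>

lemma P_add:
  assumes "z \<notin> \<Lambda>" "\<omega> \<in> \<Lambda>"
  shows "P (z + \<omega>) = P z"
proof -
  have const: "\<exists>C. \<forall>z. z \<notin> \<Lambda> \<longrightarrow> P (z + \<omega>) = P z + C" if w: "\<omega> \<in> \<Lambda>" for \<omega>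
  proof -
    let ?g = "\<lambda>z. P (z + \<omega>) - P z"
    have D: "(?g has_field_derivative 0) (at z)" if "z \<notin> \<Lambda>" for z
    proof -
      have "((\<lambda>z. P (z + \<omega>)) has_field_derivative (\<Sum>\<^sub>\<infinity>\<nu>\<in>\<Lambda>. - 2 / (z - \<nu>) ^ 3)) (at z)"
        using P_has_field_derivative[of "z + \<omega>", unfolded dP_add[OF w] DERIV_shift] that w
        by (simp only: add_mem_iff not_False_eq_True)
      from DERIV_diff[OF this P_has_field_derivative[OF that]] show ?thesis by simp
    qed
    obtain C where "\<And>z. z \<in> - \<Lambda> \<Longrightarrow> ?g z = C"
    proof (rule DERIV_zero_connected_constant[OF connected_compl open_compl, of "{}" ?g])
      show "continuous_on (- \<Lambda>) ?g"
        using D by (intro continuous_at_imp_continuous_on) (auto intro: DERIV_isCont)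
    qed (use D in auto)
    then show ?thesis by (metis ComplI add.commute diff_add_cancel)
  qed
  obtain C where C: "\<And>z. z \<notin> \<Lambda> \<Longrightarrow> P (z + \<omega>) = P z + C" using const[OF assms(2)] by blast
  have z': "- (z + \<omega>) \<notin> \<Lambda>" using assms by (simp add: add_mem_iff del: minus_add_distrib)
  txt \<open>Evenness turns the translation by \<open>\<omega>\<close> into its inverse, so \<open>C = - C\<close>.\<close>
  have "P z = P (- (z + \<omega>) + \<omega>)" by (simp add: P_uminus)
  also have "\<dots> = P (z + \<omega>) + C" using C[OF z'] by (simp only: P_uminus)
  finally show ?thesis using C[OF assms(1)] by simp
qed

lemma P_diff: "z \<notin> \<Lambda> \<Longrightarrow> \<omega> \<in> \<Lambda> \<Longrightarrow> P (z - \<omega>) = P z"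
  using P_add[of z "- \<omega>"] by simp

text \<open>The derivative is odd and periodic, and \<open>a\<close> and \<open>- a\<close> differ
  by a period.\<close>

lemma deriv_half_period:
  assumes "a \<notin> \<Lambda>" "2 * a \<in> \<Lambda>"
  shows "deriv P a = 0"
proof -
  let ?D = "\<lambda>z. \<Sum>\<^sub>\<infinity>\<omega>\<in>\<Lambda>. - 2 / (z - \<omega>) ^ 3"
  have "?D a = ?D (- a)" using dP_add[OF assms(2), of "- a"] by simp
  also have "\<dots> = (\<Sum>\<^sub>\<infinity>\<omega>\<in>\<Lambda>. (- 1) * (- 2 / (a - \<omega>) ^ 3))"
  proof (rule infsum_reindex_bij_witness[of _ uminus uminus])
    fix \<omega>
    have "(- a - \<omega>) ^ 3 = - ((a - - \<omega>) ^ 3)" by (simp add: power3_eq_cube algebra_simps)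
    then show "- 1 * (- 2 / (a - - \<omega>) ^ 3) = - 2 / (- a - \<omega>) ^ 3" by simp
  qed auto
  also have "\<dots> = (- 1) * ?D a" by (rule infsum_cmult_right')
  finally have "?D a = 0" by simp
  then show ?thesis using DERIV_imp_deriv[OF P_has_field_derivative[OF assms(1)]] by simp
qed

section \<open>Behaviour at the poles\<close>

lemma P_near_zero:
  obtains T r where "r > 0" "T holomorphic_on ball 0 r" "\<Lambda> \<inter> ball 0 r = {0}"
    and "\<And>z. z \<in> ball 0 r - {0} \<Longrightarrow> P z = 1 / z\<^sup>2 + T z"
proof -
  have "open (- (\<Lambda> - {0}))" by (intro open_Compl closed_subset) auto
  then obtain r where r: "r > 0" "cball 0 r \<subseteq> - (\<Lambda> - {0})"
    by (meson open_contains_cball ComplI DiffD2 singletonI)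
  \<comment> \<open>This is the index set of the finite sum in \<open>P_eq_tail\<close> for radius
    \<open>r / 2\<close>; only \<open>1 / z\<^sup>2\<close> and the tail remain.\<close>
  have e: "\<Lambda> \<inter> cball 0 (2 * (r / 2)) - {0} = {}" using r by auto
  show thesis
  proof (rule that[of "r / 2" "tail (r / 2)"])
    have "ball 0 (r / 2) \<subseteq> cball (0::complex) r" by (rule subset_trans[OF ball_subset_cball subset_cball]) (use r in auto)
    then show "\<Lambda> \<inter> ball 0 (r / 2) = {0}" using r zero_mem by auto
    show "P z = 1 / z\<^sup>2 + tail (r / 2) z" if "z \<in> ball 0 (r / 2) - {0}" for z
      using P_eq_tail[of "r / 2" z] that r unfolding e by simp
  qed (use r tail_holomorphic[of "r / 2"] in auto)
qed

text \<open>Periodicity moves the question to \<open>0\<close>, where \<open>1 / z\<^sup>2\<close>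
  dominates the bounded remainder.\<close>

lemma P_at_infinity:
  assumes "\<omega> \<in> \<Lambda>"
  shows "filterlim P at_infinity (at \<omega>)"
proof -
  obtain T r where T: "r > 0" "T holomorphic_on ball 0 r" "\<Lambda> \<inter> ball 0 r = {0}"
    "\<And>z. z \<in> ball 0 r - {0} \<Longrightarrow> P z = 1 / z\<^sup>2 + T z"
    using P_near_zero by metis
  have "isCont T 0"
    using T(1,2) holomorphic_on_imp_continuous_on[of T "ball 0 r"]
    by (auto simp: continuous_on_eq_continuous_at)
  then have T0: "T \<midarrow>0\<rightarrow> T 0" by (simp add: isCont_def)
  have "filterlim (\<lambda>z::complex. z\<^sup>2) (at 0) (at 0)"
    by (auto simp: filterlim_at eventually_at_filter intro!: tendsto_eq_intros)
  then have "filterlim (\<lambda>z::complex. inverse (z\<^sup>2)) at_infinity (at 0)"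
    by (rule filterlim_compose[OF filterlim_inverse_at_infinity])
  then have lim: "filterlim (\<lambda>z. T z + 1 / z\<^sup>2) at_infinity (at 0)"
    by (intro tendsto_add_filterlim_at_infinity[OF T0]) (simp add: inverse_eq_divide)
  have ev: "\<forall>\<^sub>F z in at 0. z \<in> ball 0 r - {0}"
    by (rule eventually_at_in_open) (use T(1) in simp_all)
  have "\<forall>\<^sub>F z in at 0. P (z + \<omega>) = T z + 1 / z\<^sup>2"
    using ev
  proof eventually_elim
    case (elim z)
    with T(3) have "z \<notin> \<Lambda>" by blast
    then show ?case using T(4)[OF elim] P_add[OF _ assms] by simp
  qed
  then have "filterlim (\<lambda>z. P (z + \<omega>)) at_infinity (at 0)
      \<longleftrightarrow> filterlim (\<lambda>z. T z + 1 / z\<^sup>2) at_infinity (at 0)"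
    by (rule filterlim_cong[OF refl refl])
  with lim show ?thesis
    by (subst filterlim_at_to_0) simp
qed

end

section \<open>A zero at a half-period is the only one among the half-periods\<close>

text \<open>Division by \<open>z - c\<close> is performed twice, each time with a removable
  singularity. The value assigned at \<open>c\<close> is the derivative of the numerator, which is
  \<open>0\<close> for \<open>g\<close>.\<close>

lemma double_zero_factor:
  fixes f :: "complex \<Rightarrow> complex"
  assumes hol: "f holomorphic_on S" and S: "open S" "c \<in> S" and zero: "f c = 0" "deriv f c = 0"
  obtains h where "h holomorphic_on S" "\<And>z. z \<in> S \<Longrightarrow> f z = (z - c)\<^sup>2 * h z"
proof -
  define g where "g z = (if z = c then 0 else f z / (z - c))" for z
  define h where "h z = (if z = c then deriv g c else g z / (z - c))" for z
  have g: "g holomorphic_on S"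
    by (rule pole_theorem_open_0[OF hol S(1), of c]) (auto simp: g_def zero)
  have h: "h holomorphic_on S"
    by (rule pole_theorem_open_0[OF g S(1), of c]) (auto simp: h_def g_def)
  show thesis
    by (rule that[OF h]) (auto simp: h_def g_def zero power2_eq_square)
qed

context planar_lattice
begin

lemma P_not_constant: "\<not> P constant_on - \<Lambda>"
proof
  assume "P constant_on - \<Lambda>"
  then obtain c where c: "\<And>z. z \<notin> \<Lambda> \<Longrightarrow> P z = c" by (auto simp: constant_on_def)
  have "\<forall>\<^sub>F z in at 0. z \<in> - (\<Lambda> - {0}) - {0}"
    by (intro eventually_at_in_open open_Compl closed_subset) auto
  then have "\<forall>\<^sub>F z in at 0. P z = c" by eventually_elim (auto intro: c)
  moreover have "\<forall>\<^sub>F z in at 0. norm c + 1 \<le> norm (P z)"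
    using P_at_infinity[OF zero_mem] filterlim_at_infinity[of 0 P] by (auto simp: add_nonneg_pos)
  ultimately have "\<forall>\<^sub>F z in at (0::complex). False" by eventually_elim auto
  then show False by simp
qed

lemma countable_zeros_P: "countable {z. z \<notin> \<Lambda> \<and> P z = 0}"
  using holomorphic_countable_zeros[OF P_holomorphic open_compl connected_compl
      open_imp_fsigma[OF open_compl] P_not_constant] by simp

text \<open>All values are already taken on a compact set, so Liouville's theorem applies.\<close>

lemma entire_periodic_constant:
  assumes "f holomorphic_on UNIV" "\<And>z \<omega>. \<omega> \<in> \<Lambda> \<Longrightarrow> f (z - \<omega>) = f z"
  shows "f constant_on UNIV"
proof -
  obtain K where K: "compact K" "\<And>z. \<exists>\<omega>\<in>\<Lambda>. z - \<omega> \<in> K" using cocompact by blast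
  have "range f \<subseteq> f ` K"
  proof
    fix w assume "w \<in> range f"
    then obtain z where "w = f z" by blast
    moreover obtain \<omega> where "\<omega> \<in> \<Lambda>" "z - \<omega> \<in> K" using K(2) by blast
    ultimately show "w \<in> f ` K" using assms(2)[of \<omega> z] by (metis image_eqI)
  qed
  moreover have "bounded (f ` K)"
    using assms(1) K(1)
    by (meson compact_continuous_image compact_imp_bounded continuous_on_subset
        holomorphic_on_imp_continuous_on subset_UNIV)
  ultimately show ?thesis using Liouville_theorem[OF assms(1)] bounded_subset by blast
qed

text \<open>If \<open>P a = 0\<close>, then \<open>P z * P (z + a)\<close> extends to an entire elliptic function, because the
  double pole of each factor meets a double zero of the other; it is then constant.\<close>

lemma half_period_zero_unique:
  assumes a: "a \<notin> \<Lambda>" "2 * a \<in> \<Lambda>" "P a = 0"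
    and b: "b \<notin> \<Lambda>" "b + a \<notin> \<Lambda>"
  shows "P b \<noteq> 0"
proof
  assume b0: "P b = 0"
  \<comment> \<open>Since \<open>2 * a\<close> is a period, \<open>S\<close> is a group containing
    \<open>\<Lambda>\<close> with index two. It contains the singularities of the product
    \<open>\<Phi>\<close> below and consists of periods of it.\<close>
  define S where "S = \<Lambda> \<union> {z. z + a \<in> \<Lambda>}"
  have S_diff: "z - s \<in> S \<longleftrightarrow> z \<in> S" if "s \<in> S" for s z
  proof (cases "s \<in> \<Lambda>")
    case True
    then have "z - s \<in> \<Lambda> \<longleftrightarrow> z \<in> \<Lambda>" "z + a - s \<in> \<Lambda> \<longleftrightarrow> z + a \<in> \<Lambda>"
      by (simp_all add: diff_mem_iff)
    then show ?thesis by (simp add: S_def algebra_simps)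
  next
    case False
    then have sa: "s + a \<in> \<Lambda>" using that by (simp add: S_def)
    have "z + a - (s + a) \<in> \<Lambda> \<longleftrightarrow> z + a \<in> \<Lambda>" "z + 2 * a - (s + a) \<in> \<Lambda> \<longleftrightarrow> z \<in> \<Lambda>"
      using diff_mem_iff[OF sa] add_mem_iff[OF a(2)] by blast+
    then show ?thesis by (auto simp: S_def algebra_simps)
  qed
  define \<Phi> where "\<Phi> z = P z * P (z + a)" for z
  have \<Phi>_diff: "\<Phi> (z - s) = \<Phi> z" if "s \<in> S" "z \<notin> S" for s z
  proof (cases "s \<in> \<Lambda>")
    case True
    have "P (z - s) = P z" using that(2) True by (intro P_diff) (auto simp: S_def)
    moreover have "P (z + a - s) = P (z + a)" using that(2) True by (intro P_diff) (auto simp: S_def)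
    ultimately show ?thesis by (simp add: \<Phi>_def algebra_simps)
  next
    case False
    then have sa: "s + a \<in> \<Lambda>" using that by (simp add: S_def)
    \<comment> \<open>Modulo \<open>\<Lambda>\<close>, translation by such an \<open>s\<close>
      exchanges the two factors of \<open>\<Phi>\<close>.\<close>
    have "P (z + a - (s + a)) = P (z + a)" using that(2) sa by (intro P_diff) (auto simp: S_def)
    moreover have "P (z + 2 * a - (s + a)) = P (z + 2 * a)"
      using that(2) sa a(2) by (intro P_diff) (auto simp: S_def add_mem_iff)
    moreover have "P (z + 2 * a) = P z" using that(2) a(2) by (intro P_add) (auto simp: S_def)
    ultimately show ?thesis by (simp add: \<Phi>_def algebra_simps)
  qed
  have "closed S"
  proof -
    have "{z. z + a \<in> \<Lambda>} = (\<lambda>z. z + a) -` \<Lambda>" by auto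
    moreover have "closed ((\<lambda>z. z + a) -` \<Lambda>)"
      by (intro continuous_closed_vimage closed_subset continuous_intros) auto
    ultimately show ?thesis unfolding S_def using closed_subset[of \<Lambda>] by (simp add: closed_Un)
  qed
  then have openS: "open (- S)" by (rule open_Compl)
  have "countable {z. z + a \<in> \<Lambda>}"
  proof -
    have "{z. z + a \<in> \<Lambda>} = (\<lambda>w. w - a) ` \<Lambda>" by (auto simp: image_iff) (metis add_diff_cancel_right')
    then show ?thesis using countable_lattice by simp
  qed
  then have countS: "countable S" by (simp add: S_def countable_lattice)
  have Pa_hol: "(\<lambda>z. P (z + a)) holomorphic_on {z. z + a \<notin> \<Lambda>}"
    using holomorphic_on_compose_gen[of "\<lambda>z. z + a" "{z. z + a \<notin> \<Lambda>}" P "- \<Lambda>",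
        OF _ P_holomorphic, unfolded o_def]
    by (force intro!: holomorphic_intros)
  have \<Phi>_hol: "\<Phi> holomorphic_on - S"
    unfolding \<Phi>_def
    by (intro holomorphic_on_mult holomorphic_on_subset[OF P_holomorphic]
        holomorphic_on_subset[OF Pa_hol]) (auto simp: S_def)
  obtain T r where T: "r > 0" "T holomorphic_on ball 0 r" "\<Lambda> \<inter> ball 0 r = {0}"
    "\<And>z. z \<in> ball 0 r - {0} \<Longrightarrow> P z = 1 / z\<^sup>2 + T z" using P_near_zero by metis
  define U where "U = ball 0 r \<inter> - {z. z + a \<in> \<Lambda>}"
  have U: "open U" "0 \<in> U"
  proof -
    have "- {z. z + a \<in> \<Lambda>} = (\<lambda>z. z + a) -` (- \<Lambda>)" by auto
    moreover have "open ((\<lambda>z. z + a) -` (- \<Lambda>))"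
      by (intro continuous_open_vimage open_compl continuous_intros)
    ultimately show "open U" unfolding U_def by (simp add: open_Int)
    show "0 \<in> U" using a(1) T(1) by (simp add: U_def)
  qed
  have Pa_U: "(\<lambda>z. P (z + a)) holomorphic_on U"
    by (rule holomorphic_on_subset[OF Pa_hol]) (auto simp: U_def)
  have "((\<lambda>z. P (z + a)) has_field_derivative 0) (at 0)"
    using P_has_field_derivative[OF a(1)] deriv_half_period[OF a(1,2)]
      DERIV_imp_deriv[OF P_has_field_derivative[OF a(1)]] DERIV_shift[of P 0 0 a] by simp
  then have "deriv (\<lambda>z. P (z + a)) 0 = 0" by (rule DERIV_imp_deriv)
  then obtain H where H: "H holomorphic_on U" "\<And>z. z \<in> U \<Longrightarrow> P (z + a) = (z - 0)\<^sup>2 * H z"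
    using double_zero_factor[OF Pa_U U] a(3) by auto
  \<comment> \<open>Near \<open>0\<close> the product is
    \<open>(1 / z\<^sup>2 + T z) * (z\<^sup>2 * H z)\<close>, with limit \<open>H 0\<close>; by
    periodicity the same value fits at every point of \<open>S\<close>.\<close>
  define \<Psi> where "\<Psi> z = (if z \<in> S then H 0 else \<Phi> z)" for z
  have \<Psi>_diff: "\<Psi> (z - s) = \<Psi> z" if "s \<in> S" for s z
    using S_diff[OF that] \<Phi>_diff[OF that] by (simp add: \<Psi>_def)
  have \<Psi>_U: "\<Psi> z = (1 + z\<^sup>2 * T z) * H z" if "z \<in> U" for z
  proof (cases "z = 0")
    case True
    then show ?thesis using zero_mem by (simp add: \<Psi>_def S_def)
  next
    case False
    then have z: "z \<in> ball 0 r - {0}" using that by (simp add: U_def)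
    with T(3) have "z \<notin> \<Lambda>" by blast
    then have "z \<notin> S" using that by (simp add: U_def S_def)
    then show ?thesis using H(2)[OF that] T(4)[OF z] False by (simp add: \<Psi>_def \<Phi>_def field_simps)
  qed
  have "(\<lambda>z. (1 + z\<^sup>2 * T z) * H z) holomorphic_on U"
    using H(1) holomorphic_on_subset[OF T(2), of U] by (auto simp: U_def intro!: holomorphic_intros)
  then have "\<Psi> holomorphic_on U" using \<Psi>_U by (simp cong: holomorphic_cong)
  \<comment> \<open>The point \<open>0\<close> is written \<open>s - s\<close> to fit the chain rule
    for the translation that carries \<open>s\<close> to \<open>0\<close>.\<close>
  then have \<Psi>0: "\<Psi> field_differentiable at (s - s)" for s
    using U by (auto simp: holomorphic_on_imp_differentiable_at)
  have "\<Psi> field_differentiable at z" for z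
  proof (cases "z \<in> S")
    case True
    have "(\<Psi> \<circ> (\<lambda>w. w - z)) field_differentiable at z"
      using \<Psi>0[of z] by (intro field_differentiable_compose derivative_intros)
    moreover have "\<Psi> \<circ> (\<lambda>w. w - z) = \<Psi>" using \<Psi>_diff[OF True] by (simp add: fun_eq_iff)
    ultimately show ?thesis by simp
  next
    case False
    have "\<Psi> holomorphic_on - S" using \<Phi>_hol by (rule holomorphic_transform) (simp add: \<Psi>_def)
    then show ?thesis using False openS by (auto simp: holomorphic_on_imp_differentiable_at)
  qed
  then have "\<Psi> holomorphic_on UNIV" by (simp add: holomorphic_on_def field_differentiable_at_within)
  then have "\<Psi> constant_on UNIV"
    using \<Psi>_diff by (intro entire_periodic_constant) (auto simp: S_def)
  then have "\<Psi> z = \<Psi> b" for z by (auto simp: constant_on_def)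
  moreover have "\<Psi> b = 0" using b b0 by (simp add: \<Psi>_def \<Phi>_def S_def)
  ultimately have \<Psi>z: "\<Psi> z = 0" for z by simp
  let ?Z = "{z. z \<notin> \<Lambda> \<and> P z = 0}"
  \<comment> \<open>A vanishing product would cover the plane by \<open>S\<close> and the zeros of
    the two factors, three countable sets.\<close>
  have "UNIV \<subseteq> S \<union> ?Z \<union> (\<lambda>w. w - a) ` ?Z"
  proof
    fix z :: complex
    have "z \<in> S \<or> P z * P (z + a) = 0" using \<Psi>z[of z] by (auto simp: \<Psi>_def \<Phi>_def)
    then consider "z \<in> S" | "z \<in> ?Z" | "z + a \<in> ?Z" by (auto simp: S_def)
    then show "z \<in> S \<union> ?Z \<union> (\<lambda>w. w - a) ` ?Z"
    proof cases
      case 3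
      then have "z + a - a \<in> (\<lambda>w. w - a) ` ?Z" by (rule imageI)
      then show ?thesis by simp
    qed auto
  qed
  then have "countable (UNIV :: complex set)"
    by (rule countable_subset) (auto intro: countS countable_zeros_P)
  then show False using uncountable_UNIV_complex by blast
qed

end

section \<open>Iteration\<close>

text \<open>The reciprocal extends over \<open>z\<close> with value \<open>0\<close> and is not
  constant, so by the open mapping theorem it covers a disc about \<open>0\<close>.\<close>

lemma large_values_near_pole:
  fixes f :: "complex \<Rightarrow> complex"
  assumes "f holomorphic_on U - {z}" "open U" "z \<in> U" "filterlim f at_infinity (at z)"
  obtains B where "\<And>w. norm w > B \<Longrightarrow> \<exists>x\<in>U - {z}. f x = w"
proof -
  have "\<forall>\<^sub>F x in at z. 1 \<le> norm (f x)"
    using assms(4) filterlim_at_infinity[of 0 f] by auto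
  moreover have "\<forall>\<^sub>F x in at z. x \<in> U" using assms(2,3) by (rule eventually_at_in_open')
  ultimately have "\<forall>\<^sub>F x in at z. x \<in> U \<and> 1 \<le> norm (f x)" by (rule eventually_elim2) simp
  then obtain s where s: "s > 0" "\<And>x. x \<noteq> z \<Longrightarrow> dist x z < s \<Longrightarrow> x \<in> U \<and> 1 \<le> norm (f x)"
    by (auto simp: eventually_at)
  define g where "g x = (if x = z then 0 else inverse (f x))" for x
  have "(\<lambda>x. inverse (f x)) holomorphic_on ball z s - {z}"
  proof (rule holomorphic_on_inverse)
    show "f holomorphic_on ball z s - {z}"
      by (rule holomorphic_on_subset[OF assms(1)]) (use s in \<open>auto simp: dist_commute\<close>)
    show "f x \<noteq> 0" if "x \<in> ball z s - {z}" for x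
      using s(2)[of x] that by (auto simp: dist_commute)
  qed
  moreover have "(\<lambda>x. inverse (f x)) \<midarrow>z\<rightarrow> 0"
    using filterlim_compose[OF tendsto_inverse_0 assms(4)] .
  ultimately have g: "g holomorphic_on ball z s"
    unfolding g_def by (intro removable_singularity) auto
  have "\<not> g constant_on ball z s"
  proof
    assume "g constant_on ball z s"
    moreover have "z \<in> ball z s" "z + of_real (s / 2) \<in> ball z s"
      using s(1) by (auto simp: dist_norm)
    ultimately have "g (z + of_real (s / 2)) = g z" unfolding constant_on_def by metis
    moreover have "norm (f (z + of_real (s / 2))) \<ge> 1"
      using s(2)[of "z + of_real (s / 2)"] s(1) by (auto simp: dist_norm)
    ultimately show False using s(1) by (auto simp: g_def)
  qed
  then have "open (g ` ball z s)"
    by (intro open_mapping_thm[OF g]) auto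
  moreover have "0 \<in> g ` ball z s" using s(1) by (auto simp: g_def intro!: image_eqI[of _ _ z])
  ultimately obtain d where d: "d > 0" "ball 0 d \<subseteq> g ` ball z s"
    using open_contains_ball by blast
  show thesis
  proof (rule that)
    fix w :: complex assume w: "norm w > 1 / d"
    then have "w \<noteq> 0" using d(1) by (auto simp: divide_simps split: if_splits)
    have "inverse (norm w) < inverse (1 / d)"
      using w d(1) by (intro less_imp_inverse_less) auto
    then have "inverse w \<in> ball 0 d" by (simp add: norm_inverse)
    then obtain x where x: "x \<in> ball z s" "g x = inverse w" using d(2) by (metis image_iff subsetD)
    then have "x \<noteq> z" using \<open>w \<noteq> 0\<close> by (auto simp: g_def)
    then have "f x = w" using x by (simp add: g_def)
    moreover have "x \<in> U" using s(2)[of x] x \<open>x \<noteq> z\<close> by (auto simp: dist_commute)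
    ultimately show "\<exists>x\<in>U - {z}. f x = w" using \<open>x \<noteq> z\<close> by blast
  qed
qed

context planar_lattice
begin

text \<open>\<open>h\<close> takes all large values near its pole, and \<open>\<Lambda>\<close> is
  unbounded, which gives a hit. It also makes \<open>h\<close> non-constant on a connected set, so
  fibres are countable and isolated. The last claim says that \<open>h\<close> tends to the lattice
  point without attaining it nearby, as needed to compose with \<open>P\<close>.\<close>

lemma preimage_lattice_pole:
  assumes D: "open D" "countable (- D)" and h: "h holomorphic_on D"
    and z: "\<forall>\<^sub>F l in at z. l \<in> D" "filterlim h at_infinity (at z)"
  shows preimage_lattice_nonempty: "\<exists>l\<in>D. h l \<in> \<Lambda>"
    and preimage_lattice_countable: "countable {l \<in> D. h l \<in> \<Lambda>}"
    and preimage_lattice_isolated: "\<And>l0. l0 \<in> D \<Longrightarrow> h l0 \<in> \<Lambda> \<Longrightarrow> filterlim h (at (h l0)) (at l0)"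
proof -
  have conn: "connected D" using D(2) by (rule connected_if_countable_Compl)
  obtain U where U: "open U" "z \<in> U" "\<And>l. l \<in> U \<Longrightarrow> l \<noteq> z \<Longrightarrow> l \<in> D"
    using z(1) by (auto simp: eventually_at_topological)
  then have "h holomorphic_on U - {z}" by (intro holomorphic_on_subset[OF h]) auto
  then obtain B where B: "\<And>w. norm w > B \<Longrightarrow> \<exists>x\<in>U - {z}. h x = w"
    using large_values_near_pole[OF _ U(1,2) z(2)] by metis
  have large: "\<exists>x\<in>D. h x = w" if "norm w > B" for w
    using B[OF that] U(3) by blast
  show "\<exists>l\<in>D. h l \<in> \<Lambda>" using exists_large[of B] large by metis
  have ne: "\<exists>x\<in>D. h x \<noteq> w" for w
  proof -
    \<comment> \<open>Large enough to be attained, and of norm exceeding that of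
      \<open>w\<close>.\<close>
    let ?v = "of_real (\<bar>B\<bar> + norm w + 1) :: complex"
    have v: "norm ?v = \<bar>B\<bar> + norm w + 1" by (subst norm_of_real) simp
    then have "norm ?v > B" using norm_ge_zero[of w] by linarith
    then obtain x where "x \<in> D" "h x = ?v" using large by blast
    moreover have "?v \<noteq> w" using v by force
    ultimately show ?thesis by metis
  qed
  have fiber: "countable {l \<in> D. h l = w}" for w
  proof (rule ccontr)
    assume "uncountable {l \<in> D. h l = w}"
    then have "D \<subseteq> {l \<in> D. h l = w}"
      by (intro holomorphic_countable_equal[OF h _ D(1) conn open_imp_fsigma[OF D(1)]]) auto
    then show False using ne[of w] by blast
  qed
  have "{l \<in> D. h l \<in> \<Lambda>} = (\<Union>w\<in>\<Lambda>. {l \<in> D. h l = w})" by blast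
  then show "countable {l \<in> D. h l \<in> \<Lambda>}" using fiber countable_lattice by simp
  fix l0 assume l0: "l0 \<in> D" "h l0 \<in> \<Lambda>"
  obtain x where x: "x \<in> D" "h x \<noteq> h l0" using ne by blast
  have "(\<lambda>l. h l - h l0) holomorphic_on D" by (intro holomorphic_intros h)
  then obtain r where r: "r > 0" "\<And>l. l \<in> ball l0 r - {l0} \<Longrightarrow> h l - h l0 \<noteq> 0"
    by (rule isolated_zeros[of "\<lambda>l. h l - h l0" D l0 x]) (use D(1) conn l0 x in simp_all)
  have "\<forall>\<^sub>F l in at l0. l \<in> ball l0 r - {l0}"
    by (rule eventually_at_in_open) (use r in simp_all)
  then have "\<forall>\<^sub>F l in at l0. h l \<noteq> h l0" by eventually_elim (use r(2) in auto)
  moreover have "h \<midarrow>l0\<rightarrow> h l0"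
    using holomorphic_on_imp_continuous_on[OF h] D(1) l0(1)
    by (simp add: continuous_on_eq_continuous_at isCont_def)
  ultimately show "filterlim h (at (h l0)) (at l0)" by (intro filterlim_atI)
qed

section \<open>The critical orbit as a function of the parameter\<close>

text \<open>These are the functions \<open>h\<^sub>n\<close>: iterates divided by \<open>l\<close>,
  which replaces the moving lattice by the fixed \<open>\<Lambda>\<close>.\<close>

primrec orbit :: "complex \<Rightarrow> nat \<Rightarrow> complex \<Rightarrow> complex" where
  "orbit e 0 l = e / l ^ 3"
| "orbit e (Suc n) l = P (orbit e n l) / l ^ 3"

lemma orbit_0: "orbit e 0 = (\<lambda>l. e / l ^ 3)"
  by (simp add: fun_eq_iff)

lemma orbit_Suc: "orbit e (Suc n) = (\<lambda>l. P (orbit e n l) / l ^ 3)"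
  by (simp add: fun_eq_iff)

text \<open>Only earlier hits are excluded, since after one the arbitrary value of \<open>P\<close>
  at a lattice point would enter. \<open>orbit e n\<close> itself may lie in
  \<open>\<Lambda>\<close>, as in \<open>prepole\<close>.\<close>

definition orbit_dom :: "complex \<Rightarrow> nat \<Rightarrow> complex set" where
  "orbit_dom e n = {l. l \<noteq> 0 \<and> (\<forall>k<n. orbit e k l \<notin> \<Lambda>)}"

lemma orbit_dom_Suc: "orbit_dom e (Suc n) = {l \<in> orbit_dom e n. orbit e n l \<notin> \<Lambda>}"
  by (auto simp: orbit_dom_def less_Suc_eq)

text \<open>The pole is carried along because it yields the lattice hit from which the next pole
  arises; countability of the hits keeps the complement of the domain countable.\<close>

lemma orbit_pole:
  assumes "e \<noteq> 0"
  shows "open (orbit_dom e n) \<and> countable (- orbit_dom e n) \<and> orbit e n holomorphic_on orbit_dom e n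
    \<and> (\<exists>z. (\<forall>\<^sub>F l in at z. l \<in> orbit_dom e n) \<and> filterlim (orbit e n) at_infinity (at z))"
proof (induction n)
  case 0
  have dom: "orbit_dom e 0 = - {0}" by (auto simp: orbit_dom_def)
  have "filterlim (\<lambda>l::complex. l ^ 3) (at 0) (at 0)"
    by (auto simp: filterlim_at eventually_at_filter intro!: tendsto_eq_intros)
  then have "filterlim (\<lambda>l::complex. inverse (l ^ 3)) at_infinity (at 0)"
    by (rule filterlim_compose[OF filterlim_inverse_at_infinity])
  then have "filterlim (\<lambda>l. e * inverse (l ^ 3)) at_infinity (at 0)"
    by (intro tendsto_mult_filterlim_at_infinity[OF tendsto_const assms])
  then have "filterlim (orbit e 0) at_infinity (at 0)" by (simp add: divide_inverse orbit_0)
  moreover have "\<forall>\<^sub>F l in at (0::complex). l \<in> - {0}" by (simp add: eventually_at_filter)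
  moreover have "orbit e 0 holomorphic_on - {0}" by (auto simp: orbit_0 intro!: holomorphic_intros)
  ultimately show ?case unfolding dom by (auto simp del: orbit.simps intro!: exI[of _ 0])
next
  case (Suc n)
  let ?D = "orbit_dom e n" and ?h = "orbit e n"
  have D: "open ?D" "countable (- ?D)" and h: "?h holomorphic_on ?D" using Suc by auto
  obtain z where z: "\<forall>\<^sub>F l in at z. l \<in> ?D" "filterlim ?h at_infinity (at z)" using Suc by blast
  note hit = preimage_lattice_pole[OF D h z]
  have dom: "orbit_dom e (Suc n) = ?D \<inter> ?h -` (- \<Lambda>)" by (auto simp: orbit_dom_Suc)
  have opn: "open (orbit_dom e (Suc n))"
    unfolding dom using holomorphic_on_imp_continuous_on[OF h] D(1) open_compl
    by (rule continuous_open_preimage)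
  have "- orbit_dom e (Suc n) = - ?D \<union> {l \<in> ?D. ?h l \<in> \<Lambda>}"
    by (auto simp: orbit_dom_Suc)
  then have cnt: "countable (- orbit_dom e (Suc n))" using D(2) hit(2) by simp
  have hol: "orbit e (Suc n) holomorphic_on orbit_dom e (Suc n)"
  proof -
    have "(\<lambda>l. P (?h l)) holomorphic_on orbit_dom e (Suc n)"
      using holomorphic_on_compose_gen[OF holomorphic_on_subset[OF h] P_holomorphic,
          of "orbit_dom e (Suc n)", unfolded o_def]
      by (force simp: orbit_dom_Suc)
    then have "(\<lambda>l. P (?h l) / l ^ 3) holomorphic_on orbit_dom e (Suc n)"
      by (intro holomorphic_intros) (auto simp: orbit_dom_def)
    then show ?thesis by (simp add: orbit_Suc)
  qed
  \<comment> \<open>\<open>l0\<close> leaves the domain at this stage and becomes the pole of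
    \<open>orbit e (Suc n)\<close>.\<close>
  obtain l0 where l0: "l0 \<in> ?D" "?h l0 \<in> \<Lambda>" using hit(1) by blast
  have l0_nz: "l0 \<noteq> 0" using l0(1) by (simp add: orbit_dom_def)
  have lim: "filterlim ?h (at (?h l0)) (at l0)" by (rule hit(3)[OF l0])
  \<comment> \<open>By discreteness of \<open>\<Lambda>\<close>, \<open>?h\<close> avoids all
    lattice points on a punctured neighbourhood of \<open>l0\<close>, which therefore lies in the
    new domain.\<close>
  have "\<forall>\<^sub>F w in at (?h l0). w \<in> - (\<Lambda> - {?h l0}) - {?h l0}"
    by (intro eventually_at_in_open open_Compl closed_subset) auto
  then have "\<forall>\<^sub>F l in at l0. ?h l \<in> - (\<Lambda> - {?h l0}) - {?h l0}"
    by (rule eventually_compose_filterlim[OF _ lim])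
  moreover have "\<forall>\<^sub>F l in at l0. l \<in> ?D" using D(1) l0(1) by (rule eventually_at_in_open')
  ultimately have ev: "\<forall>\<^sub>F l in at l0. l \<in> orbit_dom e (Suc n)"
    by eventually_elim (auto simp: orbit_dom_Suc)
  have lim_P: "filterlim (\<lambda>l. P (?h l)) at_infinity (at l0)"
    by (rule filterlim_compose[OF P_at_infinity[OF l0(2)] lim])
  have lim_cube: "((\<lambda>l. 1 / l ^ 3) \<longlongrightarrow> 1 / l0 ^ 3) (at l0)"
    using l0_nz by (intro tendsto_intros) auto
  have "filterlim (\<lambda>l. 1 / l ^ 3 * P (?h l)) at_infinity (at l0)"
    by (rule tendsto_mult_filterlim_at_infinity[OF lim_cube _ lim_P]) (use l0_nz in simp)
  then have "filterlim (orbit e (Suc n)) at_infinity (at l0)" by (simp add: orbit_Suc)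
  with opn cnt hol ev show ?case by blast
qed

lemma countable_orbit_hits:
  assumes "e \<noteq> 0"
  shows "countable {l \<in> orbit_dom e n. orbit e n l \<in> \<Lambda>}"
  using orbit_pole[OF assms, of n] preimage_lattice_countable by blast

section \<open>Return to the maps of the family\<close>

text \<open>By homogeneity the map sends \<open>l * w\<close> to \<open>P w / l\<^sup>2\<close>,
  which is \<open>l\<close> times \<open>P w / l ^ 3\<close>.\<close>

lemma iterate_eq_orbit:
  assumes "l \<noteq> 0"
  shows "(weierstrass_p ((*) l ` \<Lambda>) ^^ n) (e / l\<^sup>2) = l * orbit e n l"
proof (induction n)
  case 0
  then show ?case using assms by (simp add: power2_eq_square power3_eq_cube)
next
  case (Suc n)
  then show ?case
    using assms by (simp add: weierstrass_p_scale power2_eq_square power3_eq_cube)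
qed

text \<open>A half-period \<open>a\<close> is a critical point of \<open>P\<close>; the chain rule
  carries it to \<open>l * a\<close>.\<close>

lemma critical_value_scale:
  assumes "l \<noteq> 0" "a \<notin> \<Lambda>" "2 * a \<in> \<Lambda>"
  shows "P a / l\<^sup>2 \<in> critical_values ((*) l ` \<Lambda>)"
proof -
  let ?f = "weierstrass_p ((*) l ` \<Lambda>)"
  have f: "?f = (\<lambda>z. P (z / l) / l\<^sup>2)"
    using weierstrass_p_scale[OF assms(1), of \<Lambda>] assms(1) by (metis nonzero_mult_div_cancel_left times_divide_eq_right)
  have P: "(P has_field_derivative 0) (at (l * a / l))"
    using P_has_field_derivative[OF assms(2)] deriv_half_period[OF assms(2,3)] assms(1)
      DERIV_imp_deriv[OF P_has_field_derivative[OF assms(2)]] by simp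
  have "((\<lambda>z. P (z / l)) has_field_derivative 0 * (1 / l)) (at (l * a))"
    by (rule DERIV_chain2[where g = "\<lambda>z. z / l", OF P]) (auto intro!: derivative_eq_intros simp: assms(1))
  then have "(?f has_field_derivative 0) (at (l * a))"
    unfolding f using DERIV_cdivide by fastforce
  then have "deriv ?f (l * a) = 0" by (rule DERIV_imp_deriv)
  moreover have "l * a \<notin> (*) l ` \<Lambda>" using assms(1,2) by auto
  moreover have "?f (l * a) = P a / l\<^sup>2" by (rule weierstrass_p_scale[OF assms(1)])
  ultimately show ?thesis unfolding critical_values_def by force
qed

text \<open>It is enough to follow the single critical value \<open>P a / l\<^sup>2\<close>: the
  order of its prepole places \<open>l\<close> in one of countably many countable sets.\<close>

lemma countable_prepole_parameters:
  assumes a: "a \<notin> \<Lambda>" "2 * a \<in> \<Lambda>" "P a \<noteq> 0"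
  shows "countable {l. l \<noteq> 0 \<and>
    (\<forall>v \<in> critical_values ((*) l ` \<Lambda>). prepole ((*) l ` \<Lambda>) v)}" (is "countable ?A")
proof (rule countable_subset)
  show "?A \<subseteq> (\<Union>n. {l \<in> orbit_dom (P a) n. orbit (P a) n l \<in> \<Lambda>})"
  proof
    fix l assume "l \<in> ?A"
    then have l: "l \<noteq> 0" and "prepole ((*) l ` \<Lambda>) (P a / l\<^sup>2)"
      using critical_value_scale[OF _ a(1,2)] by auto
    moreover have "l * w \<in> (*) l ` \<Lambda> \<longleftrightarrow> w \<in> \<Lambda>" for w using l by auto
    ultimately obtain n where "\<forall>k<n. orbit (P a) k l \<notin> \<Lambda>" "orbit (P a) n l \<in> \<Lambda>"
      by (auto simp: prepole_def iterate_eq_orbit)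
    then show "l \<in> (\<Union>n. {l \<in> orbit_dom (P a) n. orbit (P a) n l \<in> \<Lambda>})"
      using l by (auto simp: orbit_dom_def)
  qed
  show "countable (\<Union>n. {l \<in> orbit_dom (P a) n. orbit (P a) n l \<in> \<Lambda>})"
    using countable_orbit_hits[OF a(3)] by simp
qed

text \<open>For a symmetry \<open>u\<close> of the lattice, homogeneity relates values of one and
  the same \<open>P\<close>.\<close>

lemma P_rotate:
  assumes "u \<noteq> 0" "(*) u ` \<Lambda> = \<Lambda>"
  shows "P (u * z) = P z / u\<^sup>2"
  using weierstrass_p_scale[OF assms(1), of \<Lambda> z] assms(2) by simp

end

section \<open>The two families\<close>

lemma square_lattice_eq: "square_lattice l = (*) l ` lattice 1 \<i>"
  unfolding square_lattice_def lattice_scale[symmetric] by (simp add: mult.commute)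

lemma triangular_lattice_eq:
  "triangular_lattice l = (*) l ` lattice 1 (exp (2 * complex_of_real pi * \<i> / 3))"
  unfolding triangular_lattice_def lattice_scale[symmetric] by (simp add: mult.commute)

lemma mem_lattice_1_iff:
  assumes "Im \<tau> \<noteq> 0"
  shows "of_real x + of_real y * \<tau> \<in> lattice 1 \<tau> \<longleftrightarrow> x \<in> \<int> \<and> y \<in> \<int>"
proof
  assume "of_real x + of_real y * \<tau> \<in> lattice 1 \<tau>"
  then obtain m n :: int where mn: "of_real x + of_real y * \<tau> = of_int m + of_int n * \<tau>"
    by (auto simp: mem_lattice_iff)
  from arg_cong[OF this, of Im] assms have y: "y = of_int n" by simp
  from arg_cong[OF mn, of Re] y have "x = of_int m" by simp
  with y show "x \<in> \<int> \<and> y \<in> \<int>" by simp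
next
  assume "x \<in> \<int> \<and> y \<in> \<int>"
  then obtain m n where "x = of_int m" "y = of_int n" by (auto elim!: Ints_cases)
  then show "of_real x + of_real y * \<tau> \<in> lattice 1 \<tau>" by (auto simp: mem_lattice_iff)
qed

lemma half_notin_Ints: "(1 / 2 :: real) \<notin> \<int>"
proof
  assume "(1 / 2 :: real) \<in> \<int>"
  then obtain n :: int where "1 / 2 = real_of_int n" by (auto elim: Ints_cases)
  then have "real_of_int (2 * n) = 1" by simp
  then have "2 * n = 1" by linarith
  then show False by presburger
qed

text \<open>The memberships say that \<open>u\<close> and its inverse \<open>v\<close> send the
  generators \<open>1\<close> and \<open>\<tau>\<close> into the lattice.\<close>

lemma image_mult_lattice_1:
  assumes "u \<in> lattice 1 \<tau>" "u * \<tau> \<in> lattice 1 \<tau>"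
    and "v \<in> lattice 1 \<tau>" "v * \<tau> \<in> lattice 1 \<tau>" and "u * v = 1"
  shows "(*) u ` lattice 1 \<tau> = lattice 1 \<tau>"
proof -
  have closed: "w * z \<in> lattice 1 \<tau>"
    if w: "w \<in> lattice 1 \<tau>" "w * \<tau> \<in> lattice 1 \<tau>" and z: "z \<in> lattice 1 \<tau>" for w z
  proof -
    obtain a b c d where ab: "w = of_int a + of_int b * \<tau>" and cd: "w * \<tau> = of_int c + of_int d * \<tau>"
      using w by (auto simp: mem_lattice_iff)
    obtain m n :: int where "z = of_int m + of_int n * \<tau>" using z by (auto simp: mem_lattice_iff)
    then have "w * z = of_int m * w + of_int n * (w * \<tau>)" by (simp add: algebra_simps)
    also have "\<dots> = of_int (m * a + n * c) * 1 + of_int (m * b + n * d) * \<tau>"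
      unfolding cd by (simp add: ab algebra_simps)
    finally show ?thesis unfolding mem_lattice_iff by blast
  qed
  show ?thesis
  proof
    show "(*) u ` lattice 1 \<tau> \<subseteq> lattice 1 \<tau>" using closed[OF assms(1,2)] by blast
    show "lattice 1 \<tau> \<subseteq> (*) u ` lattice 1 \<tau>"
    proof
      fix z assume z: "z \<in> lattice 1 \<tau>"
      have "z = u * (v * z)" using assms(5) by (simp add: mult.assoc[symmetric])
      then show "z \<in> (*) u ` lattice 1 \<tau>" using closed[OF assms(3,4) z] by blast
    qed
  qed
qed

theorem lemma1p4:
  shows "countable {l :: complex. l \<noteq> 0 \<and>
           (\<forall>v \<in> critical_values (triangular_lattice l). prepole (triangular_lattice l) v)} \<and>
         countable {l :: complex. l \<noteq> 0 \<and>
           (\<forall>v \<in> critical_values (square_lattice l). prepole (square_lattice l) v)}"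
proof
  define \<rho> where "\<rho> = exp (2 * complex_of_real pi * \<i> / 3)"
  have rho: "\<rho> = cis (2 * pi / 3)" by (simp add: \<rho>_def cis_conv_exp mult.commute)
  have Re: "Re \<rho> = - 1 / 2" and Im: "Im \<rho> = sqrt 3 / 2"
    unfolding rho by (simp_all add: cos_120 sin_120)
  have im: "Im \<rho> \<noteq> 0" unfolding Im by simp
  have rho2: "\<rho> * \<rho> = - 1 - \<rho>" by (simp add: complex_eq_iff Re Im)
  interpret T: planar_lattice "lattice 1 \<rho>" by (rule planar_lattice_lattice[OF im])
  note mem = mem_lattice_1_iff[OF im]
  have mems: "\<rho> \<in> lattice 1 \<rho>" "- 1 - \<rho> \<in> lattice 1 \<rho>" "1 \<in> lattice 1 \<rho>"
    using mem[of 0 1] mem[of "-1" "-1"] mem[of 1 0] by simp_all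
  \<comment> \<open>The inverse of \<open>\<rho>\<close> is its square, written in lattice
    coordinates.\<close>
  have one: "\<rho> * (- 1 - \<rho>) = 1"
    using rho2 by (simp add: right_diff_distrib)
  have rot: "(*) \<rho> ` lattice 1 \<rho> = lattice 1 \<rho>"
    by (rule image_mult_lattice_1[of _ _ "- 1 - \<rho>"])
      (use mems one rho2 in \<open>simp_all add: mult.commute\<close>)
  have half: "1 / 2 \<notin> lattice 1 \<rho>" "\<rho> * (1 / 2) \<notin> lattice 1 \<rho>"
    "\<rho> * (1 / 2) + 1 / 2 \<notin> lattice 1 \<rho>"
    using mem[of "1/2" 0] mem[of 0 "1/2"] mem[of "1/2" "1/2"] half_notin_Ints
    by (simp_all add: add.commute)
  have "T.P (1 / 2) \<noteq> 0"
  proof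
    assume 0: "T.P (1 / 2) = 0"
    \<comment> \<open>The rotation carries the zero to another half-period, incongruent to
      \<open>1 / 2\<close> by \<open>half(3)\<close>.\<close>
    then have "T.P (\<rho> * (1 / 2)) = 0" using T.P_rotate[OF _ rot, of "1 / 2"] im by force
    then show False
      using T.half_period_zero_unique[OF half(1) _ 0 half(2,3)] mems by simp
  qed
  then show "countable {l :: complex. l \<noteq> 0 \<and>
      (\<forall>v \<in> critical_values (triangular_lattice l). prepole (triangular_lattice l) v)}"
    unfolding triangular_lattice_eq \<rho>_def[symmetric]
    using T.countable_prepole_parameters[OF half(1)] mems by simp
next
  have im: "Im \<i> \<noteq> 0" by simp
  interpret S: planar_lattice "lattice 1 \<i>" by (rule planar_lattice_lattice[OF im])
  note mem = mem_lattice_1_iff[OF im]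
  have mems: "\<i> \<in> lattice 1 \<i>" "- \<i> \<in> lattice 1 \<i>" "1 \<in> lattice 1 \<i>" "- 1 \<in> lattice 1 \<i>"
    using mem[of 0 1] mem[of 0 "-1"] mem[of 1 0] mem[of "-1" 0] by simp_all
  have rot: "(*) \<i> ` lattice 1 \<i> = lattice 1 \<i>"
    by (rule image_mult_lattice_1[of _ _ "- \<i>"]) (use mems in simp_all)
  let ?b = "1 / 2 + \<i> / 2"
  have half: "1 / 2 \<notin> lattice 1 \<i>" "?b \<notin> lattice 1 \<i>" "?b + 1 / 2 \<notin> lattice 1 \<i>"
    using mem[of "1/2" 0] mem[of "1/2" "1/2"] mem[of 1 "1/2"] half_notin_Ints by simp_all
  \<comment> \<open>The centre \<open>?b\<close> of the square is fixed by the rotation modulo the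
    lattice, while \<open>P\<close> changes sign; so the zero is at \<open>?b\<close> and cannot
    also be at \<open>1 / 2\<close>.\<close>
  have "\<i> * ?b = ?b - 1" by (simp add: algebra_simps)
  then have "S.P ?b = - S.P ?b"
    using S.P_rotate[OF _ rot, of ?b] S.P_diff[OF half(2) mems(3)] by simp
  then have b: "S.P ?b = 0" by simp
  have "S.P (1 / 2) \<noteq> 0"
    using S.half_period_zero_unique[OF half(1) _ _ half(2,3)] mems b by auto
  then show "countable {l :: complex. l \<noteq> 0 \<and>
      (\<forall>v \<in> critical_values (square_lattice l). prepole (square_lattice l) v)}"
    unfolding square_lattice_eq
    using S.countable_prepole_parameters[OF half(1)] mems by simp
qed

end
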